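(* Let $k>1$. On input sequences of the server renting problem in which every item has size at most $1/k$, the algorithm Next Fit has (asymptotic) competitive ratio at most $\frac{\mu}{1-1/k}+1$. Moreover, if $k<2$ (in particular, for arbitrary input sequences with item sizes at most $1$), the competitive ratio of Next Fit is at most $2\mu+1$.
   Context: Server renting problem: items (jobs) arrive online. Each item has a size in $(0,1]$, an arrival time and a departure time; its length is departure time minus arrival time, and all lengths lie in $[\Delta,\mu\Delta]$ for fixed $\Delta>0$ and $\mu\ge 1$. On arrival of an item, the online algorithm learns its size but not its departure time, and must irrevocably assign it to a bin (server) of capacity $1$, either an already opened, not yet released bin or a newly opened bin, so that at every time the total size of the items currently present in each bin is at most $1$. A bin is released when all items assigned to it have departed. If an algorithm opens bins $B_1,\dots,B_m$, its cost is $\sum_i t_i$, where $t_i$ is the length of the interval between opening and release of $B_i$. $\mathrm{OPT}(\sigma)$ denotes the optimal offline cost. An online algorithm $A$ has (asymptotic) competitive ratio at most $c$ if there is a constant $b$ independent of $\sigma$ with $A(\sigma)\le c\cdot\mathrm{OPT}(\sigma)+b$ for all input sequences $\sigma$. Next Fit: at any time there is at most one designated "current" bin. When an item arrives, if it fits in the current bin (the total size of items present there plus the new item is at most $1$) it is placed there; otherwise the current bin is closed (no item is ever placed in it again, but it stays rented until all its items depart and it is released), and a new bin is opened for the item and becomes the current bin. If there is no current bin, a new bin is opened for the item and becomes current. *)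

theory Defs
  imports Complex_Main
begin

record item =
  item_size :: real
  arrival :: real
  departure :: real

text \<open>An item occupies its bin during the half-open interval from its arrival to its departure.\<close>

definition present_at :: "item \<Rightarrow> real \<Rightarrow> bool" where
  "present_at x t \<longleftrightarrow> arrival x \<le> t \<and> t < departure x"

text \<open>Items with equal arrival times are presented in list order.\<close>

definition inputs :: "real \<Rightarrow> real \<Rightarrow> item list set" where
  "inputs \<Delta> \<mu> = {\<sigma>. sorted (map arrival \<sigma>) \<and>
     (\<forall>x\<in>set \<sigma>. 0 < item_size x \<and> item_size x \<le> 1 \<and>
        \<Delta> \<le> departure x - arrival x \<and> departure x - arrival x \<le> \<mu> * \<Delta>)}"


text \<open>A packing lists the items in order of arrival, each with the label of its bin.\<close>

type_synonym packing = "(item \<times> nat) list"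

definition load :: "packing \<Rightarrow> nat \<Rightarrow> real \<Rightarrow> real" where
  "load p b t = (\<Sum>(x, c)\<leftarrow>p. if c = b \<and> present_at x t then item_size x else 0)"

text \<open>
  The last clause says that an item is put either into a bin that has not been used before or
  into one that has not been released, that is, one still holding an item on arrival.
\<close>

definition feasible :: "item list \<Rightarrow> packing \<Rightarrow> bool" where
  "feasible \<sigma> p \<longleftrightarrow> map fst p = \<sigma> \<and> (\<forall>b t. load p b t \<le> 1) \<and>
     (\<forall>ps x b qs. p = ps @ (x, b) # qs \<longrightarrow>
        b \<notin> snd ` set ps \<or> (\<exists>y. (y, b) \<in> set ps \<and> present_at y (arrival x)))"

definition bin_items :: "packing \<Rightarrow> nat \<Rightarrow> item set" where
  "bin_items p b = {x. (x, b) \<in> set p}"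

text \<open>
  In a feasible packing a bin is never empty between its first arrival and its last departure,
  so these are the times at which it is opened and released.
\<close>

definition rental_time :: "packing \<Rightarrow> nat \<Rightarrow> real" where
  "rental_time p b = Max (departure ` bin_items p b) - Min (arrival ` bin_items p b)"

definition cost :: "packing \<Rightarrow> real" where
  "cost p = (\<Sum>b\<in>snd ` set p. rental_time p b)"

definition OPT :: "item list \<Rightarrow> real" where
  "OPT \<sigma> = Inf {cost p | p. feasible \<sigma> p}"


text \<open>
  What an online algorithm knows about an earlier item; the departure time is known only if it
  is not in the future.
\<close>

record observation =
  obs_size :: real
  obs_arrival :: real
  obs_departure :: "real option"
  obs_bin :: nat

definition observe :: "real \<Rightarrow> item \<times> nat \<Rightarrow> observation" where
  "observe t = (\<lambda>(x, b). \<lparr>obs_size = item_size x, obs_arrival = arrival x,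
     obs_departure = (if departure x \<le> t then Some (departure x) else None), obs_bin = b\<rparr>)"

text \<open>The arguments are the observed history, the current time and the size of the new item.\<close>

type_synonym online_algorithm = "observation list \<Rightarrow> real \<Rightarrow> real \<Rightarrow> nat"

fun run_from :: "online_algorithm \<Rightarrow> packing \<Rightarrow> item list \<Rightarrow> packing" where
  "run_from A p [] = p"
| "run_from A p (x # xs) =
     run_from A (p @ [(x, A (map (observe (arrival x)) p) (arrival x) (item_size x))]) xs"

definition run :: "online_algorithm \<Rightarrow> item list \<Rightarrow> packing" where
  "run A = run_from A []"

definition competitive_ratio_at_most ::
  "online_algorithm \<Rightarrow> item list set \<Rightarrow> real \<Rightarrow> bool" where
  "competitive_ratio_at_most A I c \<longleftrightarrow> (\<exists>b. \<forall>\<sigma>\<in>I. cost (run A \<sigma>) \<le> c * OPT \<sigma> + b)"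

text \<open>
  Bins are numbered in order of opening. The bin of the latest item is the last one opened, hence
  the only candidate for being current; it is current unless all its items have departed (then it
  has been released and there is no current bin).
\<close>

definition next_fit :: online_algorithm where
  "next_fit h t s =
     (if h = [] then 0
      else let b = obs_bin (last h);
               content = filter (\<lambda>e. obs_bin e = b \<and> obs_departure e = None) h
           in if content \<noteq> [] \<and> sum_list (map obs_size content) + s \<le> 1 then b else Suc b)"


text \<open>
  Next Fit produces feasible packings, and the infimum in the definition of the optimal cost is
  taken over a nonempty set that is bounded below.
\<close>

lemma load_append: "load (p @ q) b t = load p b t + load q b t"
  by (simp add: load_def)

lemma load_mono:
  assumes "\<forall>(x, c)\<in>set p. arrival x \<le> a \<and> 0 \<le> item_size x" "a \<le> t"
  shows "load p b t \<le> load p b a"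
  unfolding load_def using assms
  by (intro sum_list_mono) (force simp: present_at_def)

lemma load_observe:
  assumes "\<forall>(x, c)\<in>set p. arrival x \<le> a"
  shows "sum_list (map obs_size
    (filter (\<lambda>e. obs_bin e = b \<and> obs_departure e = None) (map (observe a) p))) = load p b a"
  using assms by (induction p) (auto simp: load_def observe_def present_at_def)

lemma next_fit_run_from_feasible:
  assumes "sorted (map arrival xs)"
    and "\<forall>x\<in>set xs. 0 < item_size x \<and> item_size x \<le> 1"
    and "\<forall>(y, c)\<in>set p. (\<forall>x\<in>set xs. arrival y \<le> arrival x) \<and> 0 \<le> item_size y"
    and "\<forall>(y, c)\<in>set p. c \<le> snd (last p)"
    and "feasible (map fst p) p"
  shows "feasible (map fst p @ xs) (run_from next_fit p xs)"
  using assms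
proof (induction xs arbitrary: p)
  case Nil
  then show ?case by simp
next
  case (Cons x xs)
  define a where "a = arrival x"
  define b where "b = next_fit (map (observe a) p) a (item_size x)"
  define q where "q = p @ [(x, b)]"
  have arr: "\<forall>(y, c)\<in>set p. arrival y \<le> a"
    using Cons.prems(3) by (auto simp: a_def)
  have arr0: "\<forall>(y, c)\<in>set p. arrival y \<le> a \<and> 0 \<le> item_size y"
    using Cons.prems(3) by (auto simp: a_def)
  have sz: "0 < item_size x" "item_size x \<le> 1"
    using Cons.prems(2) by auto
  have cases: "(b \<notin> snd ` set p \<and> (\<forall>c\<in>snd ` set p. c \<le> b)) \<or>
    (p \<noteq> [] \<and> b = snd (last p) \<and> (\<exists>y. (y, b) \<in> set p \<and> present_at y a) \<and>
     load p b a + item_size x \<le> 1)"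
  proof (cases "p = []")
    case True
    then show ?thesis by (simp add: b_def next_fit_def)
  next
    case False
    define c where "c = snd (last p)"
    have lastc: "obs_bin (last (map (observe a) p)) = c"
      using False by (simp add: last_map c_def observe_def split_beta)
    define L where "L = filter (\<lambda>e. obs_bin e = c \<and> obs_departure e = None) (map (observe a) p)"
    have beq: "b = (if L \<noteq> [] \<and> load p c a + item_size x \<le> 1 then c else Suc c)"
      using False lastc load_observe[OF arr, of c]
      by (simp add: b_def next_fit_def Let_def L_def)
    have "\<exists>y. (y, c) \<in> set p \<and> present_at y a" if "L \<noteq> []"
    proof -
      from that obtain e where "e \<in> set L" by (meson list.set_sel(1))
      then obtain y where "(y, c) \<in> set p" "a < departure y"
        by (auto simp: L_def observe_def split: if_splits)
      then show ?thesis using arr by (auto simp: present_at_def)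
    qed
    moreover have "\<forall>c'\<in>snd ` set p. c' \<le> c"
      using Cons.prems(4) by (auto simp: c_def)
    moreover have "Suc c \<notin> snd ` set p" "\<forall>c'\<in>snd ` set p. c' \<le> Suc c"
      using calculation(2) by (meson Suc_n_not_le_n, meson le_SucI)
    ultimately show ?thesis
      unfolding c_def[symmetric] using False beq
      by (cases "L \<noteq> [] \<and> load p c a + item_size x \<le> 1") auto
  qed
  have cap: "load q c t \<le> 1" for c t
  proof -
    have p1: "load p c t \<le> 1" using Cons.prems(5) by (auto simp: feasible_def)
    show ?thesis
    proof (cases "c = b \<and> present_at x t")
      case False
      then show ?thesis using p1 by (auto simp: q_def load_append) (auto simp: load_def)
    next
      case True
      then have "a \<le> t" by (simp add: present_at_def a_def)
      from cases have "load p b a + item_size x \<le> 1"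
      proof
        assume "b \<notin> snd ` set p \<and> (\<forall>c\<in>snd ` set p. c \<le> b)"
        then have "load p b a = sum_list (map (\<lambda>_. 0) p)"
          unfolding load_def
          by (intro arg_cong[where f = sum_list] map_cong) (auto simp: rev_image_eqI)
        then show ?thesis using sz by simp
      qed blast
      moreover have "load p b t \<le> load p b a"
        using load_mono[OF arr0 \<open>a \<le> t\<close>] .
      ultimately show ?thesis using True by (simp add: q_def load_append) (simp add: load_def)
    qed
  qed
  have gap: "d \<notin> snd ` set ps \<or> (\<exists>y. (y, d) \<in> set ps \<and> present_at y (arrival z))"
    if "q = ps @ (z, d) # qs" for ps z d qs
  proof (cases qs rule: rev_cases)
    case Nil
    then have "ps = p" "z = x" "d = b" using that by (auto simp: q_def)
    then show ?thesis using cases by (auto simp: a_def)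
  next
    case (snoc qs' u)
    then have "p = ps @ (z, d) # qs'" using that by (simp add: q_def)
    then show ?thesis using Cons.prems(5) unfolding feasible_def by blast
  qed
  have "feasible (map fst q @ xs) (run_from next_fit q xs)"
  proof (rule Cons.IH)
    show "feasible (map fst q) q" using cap gap by (auto simp: feasible_def)
    show "\<forall>(y, c)\<in>set q. c \<le> snd (last q)"
    proof -
      have "c \<le> b" if "(y, c) \<in> set p" for y c
        using cases Cons.prems(4) that by (metis image_eqI prod.case snd_conv)
      then show ?thesis by (auto simp: q_def)
    qed
  qed (use Cons.prems sz in \<open>auto simp: q_def\<close>)
  then show ?case by (simp add: q_def b_def a_def)
qed

lemma next_fit_feasible:
  assumes "\<sigma> \<in> inputs \<Delta> \<mu>"
  shows "feasible \<sigma> (run next_fit \<sigma>)"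
  using next_fit_run_from_feasible[of \<sigma> "[]"] assms
  by (auto simp: inputs_def run_def feasible_def load_def)

lemma cost_nonneg:
  assumes "feasible \<sigma> p" "\<sigma> \<in> inputs \<Delta> \<mu>" "\<Delta> > 0"
  shows "cost p \<ge> 0"
  unfolding cost_def
proof (rule sum_nonneg)
  fix b assume "b \<in> snd ` set p"
  then obtain x where x: "(x, b) \<in> set p" by auto
  have "bin_items p b \<subseteq> fst ` set p" by (auto simp: bin_items_def rev_image_eqI)
  then have fin: "finite (bin_items p b)" by (rule finite_subset) simp
  have mem: "x \<in> bin_items p b" using x by (simp add: bin_items_def)
  have "x \<in> set \<sigma>" using x assms(1) by (force simp: feasible_def)
  then have "arrival x \<le> departure x" using assms(2,3) by (force simp: inputs_def)
  moreover have "Min (arrival ` bin_items p b) \<le> arrival x" using fin mem by simp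
  moreover have "departure x \<le> Max (departure ` bin_items p b)" using fin mem by simp
  ultimately show "0 \<le> rental_time p b" by (simp add: rental_time_def)
qed

lemma OPT_le_cost:
  assumes "feasible \<sigma> p" "\<sigma> \<in> inputs \<Delta> \<mu>" "\<Delta> > 0"
  shows "OPT \<sigma> \<le> cost p"
  unfolding OPT_def
proof (rule cInf_lower)
  show "bdd_below {cost p | p. feasible \<sigma> p}"
    using cost_nonneg[OF _ assms(2,3)] by (intro bdd_belowI[of _ 0]) auto
qed (use assms in auto)

end

theory Submission
  imports Defs "HOL-Analysis.Analysis"
begin

text \<open>
  A bin of Next Fit is current until it is closed or released, and it is rented for at most
  \<open>\<mu> \<Delta>\<close> after being closed. The current periods are disjoint and contained in
  the set of times at which some item is present, whose measure is at most the cost of any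
  feasible packing. So only the number \<open>n\<close> of closed bins matters. Every feasible
  packing costs at least the volume, that is, the sum of size times length over all items. A
  closed bin received items of total size more than \<open>1 - 1/k\<close>, since an item of size
  at most \<open>1/k\<close> did not fit, which gives
  \<open>n (1 - 1/k) \<Delta> \<le> OPT\<close>. In general a closed bin and the first item of the
  next bin have total size more than 1, which gives \<open>n \<Delta> \<le> 2 OPT\<close>.
\<close>

section \<open>Active times, bin volumes and rental intervals\<close>

definition active_times :: "item list \<Rightarrow> real set" where
  "active_times \<sigma> = (\<Union>x\<in>set \<sigma>. {arrival x..<departure x})"

text \<open>Summed over the list rather than over the set \<open>bin_items\<close>, so that
  identical items count with multiplicity, as they do in \<open>load\<close>.\<close>

definition bin_volume :: "packing \<Rightarrow> nat \<Rightarrow> real" where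
  "bin_volume p b =
     (\<Sum>(x, c)\<leftarrow>p. if c = b then item_size x * (departure x - arrival x) else 0)"

definition total_volume :: "item list \<Rightarrow> real" where
  "total_volume \<sigma> = (\<Sum>x\<leftarrow>\<sigma>. item_size x * (departure x - arrival x))"

definition bin_opening :: "packing \<Rightarrow> nat \<Rightarrow> real" where
  "bin_opening p b = Min (arrival ` bin_items p b)"

definition bin_release :: "packing \<Rightarrow> nat \<Rightarrow> real" where
  "bin_release p b = Max (departure ` bin_items p b)"

lemma rental_time_eq: "rental_time p b = bin_release p b - bin_opening p b"
  by (simp add: rental_time_def bin_opening_def bin_release_def)

lemma finite_bin_items [simp]: "finite (bin_items p b)"
  by (rule finite_subset[of _ "fst ` set p"]) (auto simp: bin_items_def rev_image_eqI)

lemma bin_items_snoc: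
  "bin_items (p @ [(x, c)]) b = (if c = b then insert x (bin_items p b) else bin_items p b)"
  by (auto simp: bin_items_def)

lemma bin_items_nonempty: "b \<in> snd ` set p \<Longrightarrow> bin_items p b \<noteq> {}"
  by (auto simp: bin_items_def)

lemma bin_volume_snoc:
  "bin_volume (p @ [(x, c)]) b =
     bin_volume p b + (if c = b then item_size x * (departure x - arrival x) else 0)"
  by (simp add: bin_volume_def)

lemma bin_volume_unused: "b \<notin> snd ` set p \<Longrightarrow> bin_volume p b = 0"
  by (induction p) (auto simp: bin_volume_def)

lemma bin_opening_le: "x \<in> bin_items p b \<Longrightarrow> bin_opening p b \<le> arrival x"
  by (simp add: bin_opening_def)

lemma bin_release_ge: "x \<in> bin_items p b \<Longrightarrow> departure x \<le> bin_release p b"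
  by (simp add: bin_release_def)

lemma active_times_snoc:
  "active_times (\<sigma> @ [x]) = active_times \<sigma> \<union> {arrival x..<departure x}"
  by (auto simp: active_times_def)

lemma fmeasurable_Ico [simp]: "{l..<u::real} \<in> fmeasurable lborel"
  by (rule fmeasurableI2[of "cbox l u"]) (rule fmeasurable_cbox, auto)

lemma active_times_fmeasurable [simp]: "active_times \<sigma> \<in> fmeasurable lborel"
  unfolding active_times_def
  by (intro fmeasurable.finite_UN) auto

lemma active_times_borel [simp]: "active_times \<sigma> \<in> sets borel"
  using fmeasurableD[OF active_times_fmeasurable] by simp

text \<open>Every item is counted by exactly one label, and labels that do not occur contribute 0,
  so any finite superset of the used labels will do.\<close>

lemma sum_bin_volume:
  assumes "finite B" "snd ` set p \<subseteq> B"
  shows "(\<Sum>b\<in>B. bin_volume p b) = total_volume (map fst p)"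
  using assms(2)
proof (induction p rule: rev_induct)
  case (snoc u p)
  obtain x c where u: "u = (x, c)" by (cases u)
  show ?case
    using snoc assms(1) by (simp add: u bin_volume_snoc sum.distrib total_volume_def)
qed (simp add: bin_volume_def total_volume_def)

lemma bin_volume_nonneg:
  assumes "\<forall>x\<in>fst ` set p. 0 \<le> item_size x \<and> arrival x \<le> departure x"
  shows "0 \<le> bin_volume p b"
  unfolding bin_volume_def using assms by (intro sum_list_nonneg) force

text \<open>Each item present at time \<open>t\<close> lasts at least \<open>\<Delta>\<close>. This
  turns the overflow that closes a bin into a lower bound on its volume.\<close>

lemma bin_volume_ge_load:
  assumes "\<forall>x\<in>fst ` set p. 0 \<le> item_size x \<and> \<Delta> \<le> departure x - arrival x" "0 \<le> \<Delta>"
  shows "\<Delta> * load p b t \<le> bin_volume p b"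
  unfolding load_def bin_volume_def sum_list_const_mult[symmetric]
proof (intro sum_list_mono)
  fix v assume "v \<in> set p"
  moreover obtain x c where v: "v = (x, c)" by (cases v)
  ultimately have "0 \<le> item_size x" "\<Delta> \<le> departure x - arrival x"
    using assms(1) by force+
  then have "\<Delta> * item_size x \<le> item_size x * (departure x - arrival x)"
    by (subst mult.commute) (rule mult_left_mono)
  moreover have "0 \<le> \<Delta> * item_size x" using \<open>0 \<le> item_size x\<close> \<open>0 \<le> \<Delta>\<close> by simp
  ultimately show "\<Delta> * (case v of (x, c) \<Rightarrow> if c = b \<and> present_at x t then item_size x else 0)
    \<le> (case v of (x, c) \<Rightarrow> if c = b then item_size x * (departure x - arrival x) else 0)"
    by (simp add: v)
qed


subsection \<open>Lower bounds on the cost of a packing\<close>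

text \<open>The load is a sum of step functions, one per item, each supported within
  \<open>l\<close> and \<open>u\<close> and with integral size times length.\<close>

lemma load_has_integral:
  assumes "\<forall>x\<in>bin_items p b. l \<le> arrival x \<and> arrival x \<le> departure x \<and> departure x \<le> u"
  shows "(load p b has_integral bin_volume p b) {l..u}"
  using assms
proof (induction p)
  case Nil
  then show ?case by (simp add: load_def[abs_def] bin_volume_def)
next
  case (Cons v p)
  obtain x c where v: "v = (x, c)" by (cases v)
  have IH: "(load p b has_integral bin_volume p b) {l..u}"
    using Cons by (auto simp: bin_items_def)
  have "((\<lambda>t. if c = b \<and> present_at x t then item_size x else 0) has_integral
    (if c = b then item_size x * (departure x - arrival x) else 0)) {l..u}"
  proof (cases "c = b")
    case True
    then have x: "l \<le> arrival x" "arrival x \<le> departure x" "departure x \<le> u"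
      using Cons.prems by (auto simp: v bin_items_def)
    have "((\<lambda>t. item_size x) has_integral item_size x * (departure x - arrival x))
      {arrival x..departure x}"
      using has_integral_const_real[of "item_size x" "arrival x" "departure x"] x
      by (simp add: mult.commute)
    then have "((\<lambda>t. if t \<in> {arrival x..departure x} then item_size x else 0) has_integral
      item_size x * (departure x - arrival x)) {l..u}"
      using x by (subst has_integral_restrict) auto
    \<comment> \<open>Presence is half-open while the integral is over a closed interval; the two
      integrands differ at most at \<open>departure x\<close>.\<close>
    then have "((\<lambda>t. if present_at x t then item_size x else 0) has_integral
      item_size x * (departure x - arrival x)) {l..u}"
      by (rule has_integral_spike_finite[of "{departure x}", rotated 2])
        (auto simp: present_at_def)
    then show ?thesis using True by simp
  qed simp
  from has_integral_add[OF this IH] show ?case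
    by (simp add: v load_def[abs_def] bin_volume_def)
qed

text \<open>The load never exceeds 1, so integrating it over the rental interval of a bin bounds the
  volume of the bin by its rental time.\<close>

lemma volume_le_cost:
  assumes "feasible \<sigma> p" "\<forall>x\<in>set \<sigma>. arrival x \<le> departure x"
  shows "total_volume \<sigma> \<le> cost p"
proof -
  have \<sigma>: "\<sigma> = map fst p" using assms(1) by (simp add: feasible_def)
  have "bin_volume p b \<le> rental_time p b" if b: "b \<in> snd ` set p" for b
  proof -
    define l u where "l = bin_opening p b" and "u = bin_release p b"
    have bounds: "l \<le> arrival x \<and> arrival x \<le> departure x \<and> departure x \<le> u"
      if "x \<in> bin_items p b" for x
    proof -
      have "x \<in> set \<sigma>" using that by (force simp: \<sigma> bin_items_def)
      then show ?thesis
        using that assms(2) by (auto simp: l_def u_def intro: bin_opening_le bin_release_ge)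
    qed
    obtain x where "x \<in> bin_items p b" using bin_items_nonempty[OF b] by blast
    then have "l \<le> u" using bounds by fastforce
    have int: "(load p b has_integral bin_volume p b) {l..u}"
      using bounds by (intro load_has_integral) blast
    have "((\<lambda>t. 1) has_integral u - l) {l..u}"
      using has_integral_const_real[of "1::real" l u] \<open>l \<le> u\<close> by simp
    from has_integral_le[OF int this] assms(1) show ?thesis
      by (simp add: feasible_def rental_time_eq l_def u_def)
  qed
  then show ?thesis
    unfolding cost_def \<sigma> sum_bin_volume[of "snd ` set p" p, simplified, symmetric]
    by (intro sum_mono)
qed

text \<open>The measure on the left is the span of the input. The rental intervals of the bins cover
  the active times, and measure is subadditive.\<close>

lemma active_times_le_cost:
  assumes "feasible \<sigma> p" "\<forall>x\<in>set \<sigma>. arrival x \<le> departure x"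
  shows "measure lborel (active_times \<sigma>) \<le> cost p"
proof -
  have \<sigma>: "\<sigma> = map fst p" using assms(1) by (simp add: feasible_def)
  define I where "I = (\<lambda>b. {bin_opening p b..<bin_release p b})"
  have I: "I b \<in> fmeasurable lborel" for b
    by (simp add: I_def)
  have "active_times \<sigma> \<subseteq> (\<Union>b\<in>snd ` set p. I b)"
  proof
    fix t assume "t \<in> active_times \<sigma>"
    then obtain x b where "(x, b) \<in> set p" and t: "arrival x \<le> t" "t < departure x"
      by (auto simp: active_times_def \<sigma>)
    then have "x \<in> bin_items p b" "b \<in> snd ` set p"
      by (auto simp: bin_items_def rev_image_eqI)
    then show "t \<in> (\<Union>b\<in>snd ` set p. I b)"
      using t bin_opening_le[of x p b] bin_release_ge[of x p b] by (force simp: I_def)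
  qed
  then have "measure lborel (active_times \<sigma>) \<le> measure lborel (\<Union>b\<in>snd ` set p. I b)"
    using I by (intro measure_mono_fmeasurable fmeasurable.finite_UN) (auto simp: fmeasurableD)
  also have "\<dots> \<le> (\<Sum>b\<in>snd ` set p. measure lborel (I b))"
    by (intro measure_UNION_le) (auto simp: I_def)
  also have "\<dots> = (\<Sum>b\<in>snd ` set p. rental_time p b)"
  proof (intro sum.cong refl)
    fix b assume "b \<in> snd ` set p"
    then obtain x where x: "x \<in> bin_items p b" using bin_items_nonempty by blast
    then have "x \<in> set \<sigma>" by (force simp: \<sigma> bin_items_def)
    then have "bin_opening p b \<le> bin_release p b"
      using assms(2) bin_opening_le[OF x] bin_release_ge[OF x] by force
    then show "measure lborel (I b) = rental_time p b"
      by (simp add: I_def rental_time_eq)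
  qed
  finally show ?thesis by (simp add: cost_def)
qed


subsection \<open>The cost of Next Fit\<close>

lemma run_from_append: "run_from A p (xs @ ys) = run_from A (run_from A p xs) ys"
  by (induction xs arbitrary: p) auto

lemma run_snoc:
  "run A (\<sigma> @ [x]) =
     run A \<sigma> @ [(x, A (map (observe (arrival x)) (run A \<sigma>)) (arrival x) (item_size x))]"
  by (simp add: run_def run_from_append)

lemma map_fst_run: "map fst (run A \<sigma>) = \<sigma>"
  by (induction \<sigma> rule: rev_induct) (simp_all add: run_snoc, simp add: run_def)

text \<open>The three ways in which the bin \<open>c\<close> of the latest item can meet a new item:
  still current and with room, closed by an overflow, or already released. In the first case
  \<open>y\<close> witnesses that \<open>c\<close> still holds an item.\<close>

lemma next_fit_cases:
  fixes p :: packing and a s :: real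
  defines "b \<equiv> next_fit (map (observe a) p) a s" and "c \<equiv> snd (last p)"
  assumes "p \<noteq> []" and arr: "\<forall>(y, c)\<in>set p. arrival y \<le> a"
  obtains (fits) y where "b = c" "y \<in> bin_items p c" "a < departure y"
  | (closed) "b = Suc c" "load p c a + s > 1"
  | (released) "b = Suc c" "\<forall>y\<in>bin_items p c. departure y \<le> a"
proof -
  define L where "L = filter (\<lambda>e. obs_bin e = c \<and> obs_departure e = None) (map (observe a) p)"
  have "obs_bin (last (map (observe a) p)) = c"
    using \<open>p \<noteq> []\<close> by (simp add: last_map c_def observe_def split_beta)
  then have b: "b = (if L \<noteq> [] \<and> load p c a + s \<le> 1 then c else Suc c)"
    using \<open>p \<noteq> []\<close> load_observe[OF arr, of c] by (simp add: b_def next_fit_def Let_def L_def)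
  \<comment> \<open>An observed departure is \<open>None\<close> exactly when it lies after
    \<open>a\<close>.\<close>
  have L: "L = [] \<longleftrightarrow> (\<forall>y\<in>bin_items p c. departure y \<le> a)"
    by (force simp: L_def filter_empty_conv observe_def bin_items_def split: if_splits)
  show thesis
  proof (cases "L = []")
    case True
    then show thesis using b L released by simp
  next
    case False
    then obtain y where "y \<in> bin_items p c" "a < departure y" using L by force
    then show thesis using b False fits closed by (cases "load p c a + s \<le> 1") auto
  qed
qed

text \<open>The part of \<open>U\<close> before \<open>T\<close> is disjoint from the interval from
  \<open>T\<close> to \<open>s\<close>, and both lie in \<open>V\<close> before \<open>a\<close>.
  This charges the current period of a bin opened at \<open>T\<close> to active time not yet
  charged; with \<open>s = T\<close> it is plain monotonicity.\<close>

lemma measure_extend_interval: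
  assumes "U \<in> fmeasurable lborel" "V \<in> fmeasurable lborel" "U \<subseteq> V"
    and "T \<le> s" "s \<le> a" "{T..<s} \<subseteq> V"
  shows "measure lborel (U \<inter> {..<T}) + (s - T) \<le> measure lborel (V \<inter> {..<(a::real)})"
proof -
  have fm: "U \<inter> {..<T} \<in> fmeasurable lborel" "{T..<s} \<in> fmeasurable lborel"
    using fmeasurable_Int_fmeasurable[OF assms(1), of "{..<T}"] by auto
  have "measure lborel (U \<inter> {..<T}) + (s - T) = measure lborel (U \<inter> {..<T} \<union> {T..<s})"
    using fm \<open>T \<le> s\<close> by (subst measure_Un_AE) auto
  also have "\<dots> \<le> measure lborel (V \<inter> {..<a})"
    using assms fm
    by (intro measure_mono_fmeasurable fmeasurable_Int_fmeasurable) (auto simp: fmeasurableD)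
  finally show ?thesis .
qed

text \<open>
  \<open>n\<close> counts the bins closed because an item did not fit; bins released while current
  are not counted.
\<close>

definition next_fit_invariant ::
  "real \<Rightarrow> real \<Rightarrow> real \<Rightarrow> item list \<Rightarrow> packing \<Rightarrow> nat \<Rightarrow> nat \<Rightarrow> bool" where
  "next_fit_invariant \<Delta> \<mu> \<delta> \<sigma> p c n \<longleftrightarrow>
     snd ` set p = {..c} \<and>
     {bin_opening p c..<bin_release p c} \<subseteq> active_times \<sigma> \<and>
     (\<Sum>b<c. rental_time p b) \<le>
       measure lborel (active_times \<sigma> \<inter> {..<bin_opening p c}) + real n * (\<mu> * \<Delta>) \<and>
     real n * ((1 - \<delta>) * \<Delta>) \<le> (\<Sum>b<c. bin_volume p b) \<and>
     real n * \<Delta> \<le> 2 * (\<Sum>b<c. bin_volume p b) + bin_volume p c"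

lemma next_fit_invariant_first:
  "next_fit_invariant \<Delta> \<mu> \<delta> [x] [(x, 0)] 0 0"
  if "0 \<le> item_size x" "arrival x \<le> departure x"
  using that
  by (auto simp: next_fit_invariant_def active_times_def bin_items_def bin_opening_def
      bin_release_def bin_volume_def)

text \<open>Induction over the arriving items. Active time before the opening of the current bin
  pays for the current periods of all earlier bins, and each closed bin adds at most
  \<open>\<mu> * \<Delta>\<close>. In the last clause of the invariant an earlier bin may be used
  twice, once for its own overflow and once because it received the item that overflowed its
  predecessor; the current bin has so far been used at most once, as a receiver.\<close>

lemma next_fit_invariant_run:
  assumes "\<sigma> \<in> inputs \<Delta> \<mu>" "\<forall>x\<in>set \<sigma>. item_size x \<le> \<delta>" "\<Delta> > 0" "\<sigma> \<noteq> []"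
  shows "\<exists>n. next_fit_invariant \<Delta> \<mu> \<delta> \<sigma> (run next_fit \<sigma>) (snd (last (run next_fit \<sigma>))) n"
  using assms(1,2,4)
proof (induction \<sigma> rule: rev_induct)
  case (snoc x \<sigma>)
  show ?case
  proof (cases "\<sigma> = []")
    case True
    then have "run next_fit (\<sigma> @ [x]) = [(x, 0)]" by (simp add: run_def next_fit_def)
    then show ?thesis
      using next_fit_invariant_first[of x] snoc.prems True \<open>\<Delta> > 0\<close>
      by (force simp: inputs_def)
  next
    case False
    define p where "p = run next_fit \<sigma>"
    define c where "c = snd (last p)"
    define a where "a = arrival x"
    define d where "d = departure x"
    define b where "b = next_fit (map (observe a) p) a (item_size x)"
    define q where "q = p @ [(x, b)]"
    define T where "T = bin_opening p c"
    define R where "R = bin_release p c"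
    have fst_p: "map fst p = \<sigma>" by (simp add: p_def map_fst_run)
    then have "p \<noteq> []" using False by auto
    have set_\<sigma>: "set \<sigma> = fst ` set p" by (simp flip: fst_p)
    have q: "run next_fit (\<sigma> @ [x]) = q"
      by (simp add: run_snoc q_def b_def p_def a_def)
    have last_q: "snd (last q) = b" by (simp add: q_def)
    have items: "0 < item_size y" "\<Delta> \<le> departure y - arrival y"
        "departure y \<le> arrival y + \<mu> * \<Delta>" "arrival y \<le> a" if "y \<in> set \<sigma>" for y
      using snoc.prems(1) that by (auto simp: inputs_def a_def sorted_append)
    have x: "0 < item_size x" "item_size x \<le> \<delta>" "\<Delta> \<le> d - a"
      using snoc.prems by (auto simp: inputs_def a_def d_def)
    have "a < d" using x \<open>\<Delta> > 0\<close> by linarith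
    have "\<sigma> \<in> inputs \<Delta> \<mu>" "\<forall>y\<in>set \<sigma>. item_size y \<le> \<delta>"
      using snoc.prems by (auto simp: inputs_def sorted_append)
    from snoc.IH[OF this False]
    obtain n where n: "next_fit_invariant \<Delta> \<mu> \<delta> \<sigma> p c n" by (auto simp: p_def c_def)
    note inv = n[unfolded next_fit_invariant_def, folded T_def R_def]
    have bin_subset: "bin_items p c \<subseteq> set \<sigma>" by (force simp: bin_items_def set_\<sigma>)
    have ne: "bin_items p c \<noteq> {}" using inv by (intro bin_items_nonempty) auto
    have "T \<le> a"
      using ne bin_subset items(4) bin_opening_le unfolding T_def
      by (meson all_not_in_conv order_trans subsetD)
    have "T \<le> R"
    proof -
      obtain y where y: "y \<in> bin_items p c" using ne by blast
      then have "arrival y \<le> departure y" using bin_subset items(2)[of y] \<open>\<Delta> > 0\<close> by auto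
      then show ?thesis
        using bin_opening_le[OF y] bin_release_ge[OF y] by (simp add: T_def R_def)
    qed
    \<comment> \<open>All items of \<open>c\<close> have arrived by \<open>a\<close>, and none lasts
      longer than \<open>\<mu> * \<Delta>\<close>.\<close>
    have "R \<le> a + \<mu> * \<Delta>"
      unfolding R_def bin_release_def using ne bin_subset items(3,4)
      by (subst Max_le_iff) (auto, smt (verit) subsetD)
    have vol: "0 \<le> bin_volume p b'" for b'
      using items \<open>\<Delta> > 0\<close> unfolding set_\<sigma> by (intro bin_volume_nonneg) (smt (verit))
    have xvol: "\<Delta> * item_size x \<le> item_size x * (d - a)"
      using x by (simp add: mult.commute mult_left_mono)
    then have xvol0: "0 \<le> item_size x * (d - a)"
      using x \<open>\<Delta> > 0\<close> by (smt (verit) mult_nonneg_nonneg)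
    have act: "active_times (\<sigma> @ [x]) = active_times \<sigma> \<union> {a..<d}"
      by (simp add: active_times_snoc a_def d_def)
    then have act_mono: "active_times \<sigma> \<subseteq> active_times (\<sigma> @ [x])" by simp
    have vol_q: "bin_volume q b' = bin_volume p b' + (if b = b' then item_size x * (d - a) else 0)"
      for b' by (simp add: q_def bin_volume_snoc a_def d_def)
    have rental_q: "rental_time q b' = rental_time p b'" if "b' \<noteq> b" for b'
      using that by (simp add: rental_time_def q_def bin_items_snoc)
    \<comment> \<open>Shared by the cases \<open>closed\<close>, with \<open>n'\<close> equal to
      \<open>Suc n\<close>, and \<open>released\<close>, with \<open>n'\<close> equal to
      \<open>n\<close>. The current period of \<open>c\<close> ends at \<open>min R a\<close>; the
      rest of its rental must be paid for by the increase of the counter.\<close>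
    have new_bin: "next_fit_invariant \<Delta> \<mu> \<delta> (\<sigma> @ [x]) q b n'"
      if b: "b = Suc c" and R: "R \<le> min R a + (real n' - n) * (\<mu> * \<Delta>)"
        and n1: "real n' * ((1 - \<delta>) * \<Delta>) \<le> (\<Sum>b\<le>c. bin_volume p b)"
        and n2: "real n' * \<Delta> \<le> 2 * (\<Sum>b\<le>c. bin_volume p b) + item_size x * (d - a)" for n'
    proof -
      have "Suc c \<notin> snd ` set p" using inv by simp
      then have empty: "bin_items p b = {}" "bin_volume p b = 0"
        by (force simp: b bin_items_def, simp add: b bin_volume_unused)
      have op: "bin_opening q b = a" "bin_release q b = d"
        using empty by (auto simp: q_def bin_items_snoc bin_opening_def bin_release_def a_def d_def)
      have "(\<Sum>b'<b. rental_time q b') = (\<Sum>b'<c. rental_time p b') + (R - T)"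
        using rental_q by (simp add: b rental_time_eq R_def T_def)
      also have "\<dots> \<le> measure lborel (active_times \<sigma> \<inter> {..<T}) + (min R a - T) + real n' * (\<mu> * \<Delta>)"
        using inv R by (simp add: algebra_simps)
      also have "\<dots> \<le> measure lborel (active_times (\<sigma> @ [x]) \<inter> {..<a}) + real n' * (\<mu> * \<Delta>)"
      proof -
        have "{T..<min R a} \<subseteq> active_times (\<sigma> @ [x])" using inv act by force
        then show ?thesis
          using measure_extend_interval[of "active_times \<sigma>" "active_times (\<sigma> @ [x])" T "min R a" a]
            \<open>T \<le> a\<close> \<open>T \<le> R\<close> act_mono by simp
      qed
      finally have "(\<Sum>b'<b. rental_time q b') \<le> \<dots>" .
      moreover have "(\<Sum>b'<b. bin_volume q b') = (\<Sum>b'\<le>c. bin_volume p b')"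
        unfolding b lessThan_Suc_atMost by (intro sum.cong) (auto simp: vol_q b)
      moreover have "snd ` set q = {..b}" using inv by (auto simp: q_def b)
      ultimately show ?thesis
        using n1 n2 empty op act by (simp add: next_fit_invariant_def vol_q)
    qed
    have sums: "(\<Sum>b\<le>c. bin_volume p b) = (\<Sum>b<c. bin_volume p b) + bin_volume p c"
      by (simp flip: lessThan_Suc_atMost)
    have arr: "\<forall>(y, c)\<in>set p. arrival y \<le> a"
      using items(4) by (force simp: set_\<sigma>)
    have "\<exists>n. next_fit_invariant \<Delta> \<mu> \<delta> (\<sigma> @ [x]) q b n"
      using \<open>p \<noteq> []\<close> arr
    proof (cases rule: next_fit_cases[of p a "item_size x", folded b_def c_def,
          consumes 2, case_names fits closed released])
      case (fits y)
      have op: "bin_opening q b = T"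
        using fits ne \<open>T \<le> a\<close>
        by (simp add: q_def bin_items_snoc bin_opening_def T_def a_def min_absorb2)
      have rel: "bin_release q b = max d R"
        using fits ne by (simp add: q_def bin_items_snoc bin_release_def R_def d_def)
      \<comment> \<open>Since \<open>c\<close> is still occupied at \<open>a\<close>, adding the
        item leaves no gap: the extended rental interval stays inside the active times.\<close>
      have "a < R" using fits bin_release_ge[of y p c] by (simp add: R_def)
      then have "{T..<max d R} \<subseteq> {T..<R} \<union> {a..<d}" by auto
      then have "{T..<max d R} \<subseteq> active_times (\<sigma> @ [x])" using inv act by blast
      moreover have "measure lborel (active_times \<sigma> \<inter> {..<T}) \<le>
        measure lborel (active_times (\<sigma> @ [x]) \<inter> {..<T})"
        using measure_extend_interval[of "active_times \<sigma>" "active_times (\<sigma> @ [x])" T T T] act_mono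
        by simp
      moreover have "(\<Sum>b'<b. rental_time q b') = (\<Sum>b'<b. rental_time p b')"
        using rental_q by (intro sum.cong) auto
      moreover have "(\<Sum>b'<b. bin_volume q b') = (\<Sum>b'<b. bin_volume p b')"
        by (intro sum.cong) (auto simp: vol_q)
      moreover have "snd ` set q = {..b}" using inv fits by (auto simp: q_def)
      ultimately have "next_fit_invariant \<Delta> \<mu> \<delta> (\<sigma> @ [x]) q b n"
        using inv op rel xvol0 fits(1) by (simp add: next_fit_invariant_def vol_q)
      then show ?thesis ..
    next
      case closed
      have load: "\<Delta> * load p c a \<le> bin_volume p c"
        using items \<open>\<Delta> > 0\<close> unfolding set_\<sigma> by (intro bin_volume_ge_load) (auto intro: less_imp_le)
      \<comment> \<open>The overflow is used in two ways: the rejected item has size at most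
        \<open>\<delta>\<close>, so the load alone exceeds \<open>1 - \<delta>\<close>; together
        with that item it exceeds 1.\<close>
      have "\<Delta> * (1 - \<delta>) \<le> \<Delta> * load p c a" "\<Delta> * 1 \<le> \<Delta> * (load p c a + item_size x)"
        using closed x \<open>\<Delta> > 0\<close> by (auto intro!: mult_left_mono)
      then have 1: "(1 - \<delta>) * \<Delta> \<le> bin_volume p c"
        and 2: "\<Delta> \<le> bin_volume p c + item_size x * (d - a)"
        using load xvol by (auto simp: algebra_simps)
      have "next_fit_invariant \<Delta> \<mu> \<delta> (\<sigma> @ [x]) q b (Suc n)"
      proof (rule new_bin)
        \<comment> \<open>For \<open>R\<close> at most \<open>a\<close> this requires
          \<open>\<mu> * \<Delta>\<close> to be nonnegative, which follows from the length of any
          item in the bin.\<close>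
        show "R \<le> min R a + (real (Suc n) - n) * (\<mu> * \<Delta>)"
          using \<open>R \<le> a + \<mu> * \<Delta>\<close> assms(3) items ne bin_subset by (force simp: min_def)
        show "real (Suc n) * ((1 - \<delta>) * \<Delta>) \<le> (\<Sum>b\<le>c. bin_volume p b)"
          using inv 1 by (simp add: sums distrib_right)
        \<comment> \<open>The old bound counts the volume of \<open>c\<close> once. Its overflow
          counts it a second time, and counts the item opening the new bin once.\<close>
        show "real (Suc n) * \<Delta> \<le> 2 * (\<Sum>b\<le>c. bin_volume p b) + item_size x * (d - a)"
          using inv 2 by (simp add: sums distrib_right)
      qed (use closed in simp)
      then show ?thesis ..
    next
      case released
      have "R \<le> a" using released ne by (simp add: R_def bin_release_def)
      have "next_fit_invariant \<Delta> \<mu> \<delta> (\<sigma> @ [x]) q b n"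
        using released inv vol[of c] xvol0 \<open>R \<le> a\<close> by (intro new_bin) (auto simp: sums)
      then show ?thesis ..
    qed
    then show ?thesis by (simp add: q last_q)
  qed
qed simp

text \<open>The invariant at the end of the input, completed by the last bin: it was never closed,
  so its whole rental interval is charged to active time.\<close>

lemma next_fit_cost:
  assumes "\<sigma> \<in> inputs \<Delta> \<mu>" "\<forall>x\<in>set \<sigma>. item_size x \<le> \<delta>" "\<Delta> > 0"
  obtains n :: nat where
    "cost (run next_fit \<sigma>) \<le> measure lborel (active_times \<sigma>) + real n * (\<mu> * \<Delta>)"
    "real n * ((1 - \<delta>) * \<Delta>) \<le> total_volume \<sigma>"
    "real n * \<Delta> \<le> 2 * total_volume \<sigma>"
proof (cases "\<sigma> = []")
  case True
  then show thesis by (intro that[of 0]) (auto simp: run_def cost_def total_volume_def)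
next
  case False
  define p where "p = run next_fit \<sigma>"
  define c where "c = snd (last p)"
  obtain n where n: "next_fit_invariant \<Delta> \<mu> \<delta> \<sigma> p c n"
    using next_fit_invariant_run[OF assms False] by (auto simp: p_def c_def)
  note inv = n[unfolded next_fit_invariant_def]
  have fst_p: "map fst p = \<sigma>" by (simp add: p_def map_fst_run)
  have items: "0 \<le> item_size y \<and> arrival y \<le> departure y" if "y \<in> set \<sigma>" for y
    using assms(1,3) that by (force simp: inputs_def)
  then have vol: "0 \<le> bin_volume p c"
    by (intro bin_volume_nonneg) (simp flip: fst_p)
  have sum: "total_volume \<sigma> = (\<Sum>b<c. bin_volume p b) + bin_volume p c"
    using sum_bin_volume[of "{..c}" p] inv by (simp add: fst_p flip: lessThan_Suc_atMost)
  obtain y where y: "y \<in> bin_items p c" using inv bin_items_nonempty[of c p] by auto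
  then have "y \<in> set \<sigma>" by (force simp: bin_items_def simp flip: fst_p)
  then have le: "bin_opening p c \<le> bin_release p c"
    using items bin_opening_le[OF y] bin_release_ge[OF y] by force
  have "cost p = (\<Sum>b<c. rental_time p b) + (bin_release p c - bin_opening p c)"
    using inv by (simp add: cost_def rental_time_eq flip: lessThan_Suc_atMost)
  also have "\<dots> \<le> measure lborel (active_times \<sigma> \<inter> {..<bin_opening p c})
      + (bin_release p c - bin_opening p c) + real n * (\<mu> * \<Delta>)"
    using inv by simp
  also have "\<dots> \<le> measure lborel (active_times \<sigma> \<inter> {..<bin_release p c}) + real n * (\<mu> * \<Delta>)"
    using measure_extend_interval[of "active_times \<sigma>" "active_times \<sigma>"] inv le by simp
  also have "\<dots> \<le> measure lborel (active_times \<sigma>) + real n * (\<mu> * \<Delta>)"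
    by (intro add_right_mono measure_mono_fmeasurable) (auto simp: fmeasurableD)
  finally show thesis
    using inv vol by (intro that[of n]) (auto simp: p_def sum)
qed

section \<open>Comparison with the optimal cost\<close>

lemma next_fit_le_OPT:
  assumes "\<sigma> \<in> inputs \<Delta> \<mu>" "\<Delta> > 0" "0 \<le> \<kappa>"
    and bound: "cost (run next_fit \<sigma>) \<le> measure lborel (active_times \<sigma>) + \<kappa> * total_volume \<sigma>"
  shows "cost (run next_fit \<sigma>) \<le> (\<kappa> + 1) * OPT \<sigma>"
proof -
  have len: "\<forall>x\<in>set \<sigma>. arrival x \<le> departure x"
    using assms(1,2) by (force simp: inputs_def)
  \<comment> \<open>\<open>OPT\<close> is an infimum, so after division it suffices to bound the
    cost of every feasible packing from below; Next Fit itself shows that there is one.\<close>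
  have "cost (run next_fit \<sigma>) / (\<kappa> + 1) \<le> OPT \<sigma>"
    unfolding OPT_def
  proof (rule cInf_greatest)
    fix z assume "z \<in> {cost p |p. feasible \<sigma> p}"
    then obtain p where z: "z = cost p" and p: "feasible \<sigma> p" by blast
    have "cost (run next_fit \<sigma>) \<le> cost p + \<kappa> * cost p"
      using bound active_times_le_cost[OF p len]
        mult_left_mono[OF volume_le_cost[OF p len] \<open>0 \<le> \<kappa>\<close>] by linarith
    then show "cost (run next_fit \<sigma>) / (\<kappa> + 1) \<le> z"
      using \<open>0 \<le> \<kappa>\<close> by (simp add: z field_simps)
  qed (use next_fit_feasible[OF assms(1)] in auto)
  then show ?thesis using \<open>0 \<le> \<kappa>\<close> by (simp add: field_simps)
qed

lemma next_fit_small_items: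
  assumes "\<sigma> \<in> inputs \<Delta> \<mu>" "\<forall>x\<in>set \<sigma>. item_size x \<le> \<delta>" "\<Delta> > 0" "0 \<le> \<mu>" "\<delta> < 1"
  shows "cost (run next_fit \<sigma>) \<le> (\<mu> / (1 - \<delta>) + 1) * OPT \<sigma>"
proof -
  obtain n :: nat where n:
    "cost (run next_fit \<sigma>) \<le> measure lborel (active_times \<sigma>) + real n * (\<mu> * \<Delta>)"
    "real n * ((1 - \<delta>) * \<Delta>) \<le> total_volume \<sigma>"
    using next_fit_cost[OF assms(1-3)] by metis
  \<comment> \<open>Each closed bin costs \<open>\<mu> * \<Delta>\<close> extra and accounts for
    volume \<open>(1 - \<delta>) * \<Delta>\<close>; the quotient is the factor
    \<open>\<kappa>\<close>.\<close>
  have "real n * (\<mu> * \<Delta>) = \<mu> / (1 - \<delta>) * (real n * ((1 - \<delta>) * \<Delta>))"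
    using \<open>\<delta> < 1\<close> by simp
  also have "\<dots> \<le> \<mu> / (1 - \<delta>) * total_volume \<sigma>"
    using n(2) assms(4,5) by (intro mult_left_mono) auto
  finally show ?thesis using n(1) assms by (intro next_fit_le_OPT) auto
qed

lemma next_fit_arbitrary_items:
  assumes "\<sigma> \<in> inputs \<Delta> \<mu>" "\<Delta> > 0" "0 \<le> \<mu>"
  shows "cost (run next_fit \<sigma>) \<le> (2 * \<mu> + 1) * OPT \<sigma>"
proof -
  \<comment> \<open>This permits \<open>\<delta> = 1\<close> in \<open>next_fit_cost\<close>, whose
    last estimate, from pairing a closed bin with the item that overflowed it, is independent of
    \<open>\<delta>\<close>.\<close>
  have "\<forall>x\<in>set \<sigma>. item_size x \<le> 1" using assms(1) by (simp add: inputs_def)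
  then obtain n :: nat where n:
    "cost (run next_fit \<sigma>) \<le> measure lborel (active_times \<sigma>) + real n * (\<mu> * \<Delta>)"
    "real n * \<Delta> \<le> 2 * total_volume \<sigma>"
    using next_fit_cost[OF assms(1) _ assms(2)] by metis
  have "real n * (\<mu> * \<Delta>) \<le> 2 * \<mu> * total_volume \<sigma>"
    using mult_left_mono[OF n(2) \<open>0 \<le> \<mu>\<close>] by (simp add: algebra_simps)
  then show ?thesis using n(1) assms by (intro next_fit_le_OPT) auto
qed

theorem theorem2:
  fixes \<Delta> \<mu> :: real
  assumes "\<Delta> > 0" and "\<mu> \<ge> 1"
  shows "(\<forall>k::real. k > 1 \<longrightarrow>
            competitive_ratio_at_most next_fit
              {\<sigma> \<in> inputs \<Delta> \<mu>. \<forall>x\<in>set \<sigma>. item_size x \<le> 1 / k} (\<mu> / (1 - 1 / k) + 1) \<and>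
            (k < 2 \<longrightarrow>
              competitive_ratio_at_most next_fit
                {\<sigma> \<in> inputs \<Delta> \<mu>. \<forall>x\<in>set \<sigma>. item_size x \<le> 1 / k} (2 * \<mu> + 1))) \<and>
         competitive_ratio_at_most next_fit (inputs \<Delta> \<mu>) (2 * \<mu> + 1)"
  unfolding competitive_ratio_at_most_def
  using assms
  \<comment> \<open>The additive constant is 0, so the ratios hold absolutely. The claim for
    \<open>k < 2\<close> is the bound for arbitrary items on a smaller set of inputs.\<close>
  by (auto intro!: exI[of _ 0] next_fit_small_items next_fit_arbitrary_items)

end
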